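(* Let $a>0$, $b>0$, $c>-1$ be real numbers and define $$\Omega(x)={}_2F_3\left(a,\ a+\tfrac12;\ c+1,\ a+b,\ a+b+\tfrac12;\ -\frac{x^2}{4}\right)\qquad(x>0).$$ Then $\Omega(x)>0$ for all $x>0$ if $a,b,c$ satisfy simultaneously $$\frac c2+\frac34\le a<\min\left(c+1,\ b+\frac c2+\frac14\right)\quad\text{and}\quad -b+\frac c2+\frac54<2a\le b+\frac{3c}{2}+\frac34.$$ Moreover: (i) In the boundary case $a=b+\frac c2+\frac14$, one also has $\Omega(x)>0$ for all $x>0$ if $$\frac12<b\le\frac c2+\frac14,\qquad c>\frac12.$$ (ii) In the boundary case $c=a-1$, one also has $\Omega(x)>0$ for all $x>0$ if $$b\ge\max\left[1,\ \frac12\left(a+\frac32\right)\right],\qquad (a,b)\ne\left(\frac12,1\right).$$ In the case $c=a-1$ and $(a,b)=\left(\frac12,1\right)$, one has $\Omega(x)\ge0$ for all $x>0$.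
   Context: ${}_2F_3(a_1,a_2;b_1,b_2,b_3;z)=\sum_{k=0}^\infty\frac{(a_1)_k(a_2)_k}{(b_1)_k(b_2)_k(b_3)_k}\frac{z^k}{k!}$ is the generalized hypergeometric function, where $(\alpha)_0=1$ and $(\alpha)_k=\alpha(\alpha+1)\cdots(\alpha+k-1)$ for $k\ge1$. *)

theory Defs
  imports "HOL-Analysis.Analysis" "HOL-Real_Asymp.Real_Asymp"
begin

definition hyp2F3 :: "real \<Rightarrow> real \<Rightarrow> real \<Rightarrow> real \<Rightarrow> real \<Rightarrow> real \<Rightarrow> real" where
  "hyp2F3 a1 a2 b1 b2 b3 z =
     (\<Sum>k. pochhammer a1 k * pochhammer a2 k /
            (pochhammer b1 k * pochhammer b2 k * pochhammer b3 k) * (z ^ k / fact k))"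

(* Agreement with the library's formal hypergeometric series. *)
lemma hyp2F3_eq_eval_fps:
  "hyp2F3 a1 a2 b1 b2 b3 z = eval_fps (fps_hypergeo [a1, a2] [b1, b2, b3] 1) z"
  by (simp add: hyp2F3_def eval_fps_def)

(* The series converges everywhere, so suminf in hyp2F3_def is its actual sum. *)
lemma summable_hyp2F3:
  fixes a1 a2 b1 b2 b3 z :: real
  assumes "b1 > 0" "b2 > 0" "b3 > 0"
  shows "summable (\<lambda>k. pochhammer a1 k * pochhammer a2 k /
            (pochhammer b1 k * pochhammer b2 k * pochhammer b3 k) * (z ^ k / fact k))"
    (is "summable ?f")
proof -
  define r where "r = (\<lambda>n. (a1 + real n) * (a2 + real n) * z /
    ((b1 + real n) * (b2 + real n) * (b3 + real n) * (1 + real n)))"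
  have step: "?f (Suc n) = r n * ?f n" for n
    by (simp add: r_def pochhammer_Suc mult_ac)
  have "r \<longlonglongrightarrow> 0"
    unfolding r_def by real_asymp
  then have "eventually (\<lambda>n. norm (r n) < 1/2) sequentially"
    by (auto simp: tendsto_iff dist_norm elim!: allE[of _ "1/2"])
  then obtain N where N: "\<And>n. n \<ge> N \<Longrightarrow> norm (r n) < 1/2"
    by (auto simp: eventually_sequentially)
  show ?thesis
  proof (rule summable_ratio_test)
    show "norm (?f (Suc n)) \<le> 1/2 * norm (?f n)" if "n \<ge> N" for n
      unfolding step norm_mult[of "r n"] using N[OF that] by (intro mult_right_mono) auto
  qed simp
qed

definition Omega :: "real \<Rightarrow> real \<Rightarrow> real \<Rightarrow> real \<Rightarrow> real" where
  "Omega a b c x = hyp2F3 a (a + 1/2) (c + 1) (a + b) (a + b + 1/2) (- (x\<^sup>2 / 4))"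

end

theory Submission
  imports Defs
begin

text \<open>
  In the variable \<open>w = x\<^sup>2/4\<close> the function \<open>\<Omega>\<close> is a power series with coefficients
  \<open>(-1)\<^sup>k (a)\<^sub>k (a+1/2)\<^sub>k / ((c+1)\<^sub>k (a+b)\<^sub>k (a+b+1/2)\<^sub>k k!)\<close>.  It is positive because
  it arises from a manifestly nonnegative function by taking weighted averages of dilations.

  The nonnegative function is the square of a Bessel function.  By Vandermonde's identity,
  \<open>({}\<^sub>0F\<^sub>1(\<nu>+1; -w/4))\<^sup>2 = {}\<^sub>1F\<^sub>2(\<nu>+1/2; \<nu>+1, 2\<nu>+1; -w)\<close> for \<open>\<nu> > -1/2\<close>
  (\<open>nonneg_series_bessel_square\<close>).

  If \<open>m\<^sub>k = \<integral> t\<^sup>k d\<mu>(t)\<close> are the moments of a probability measure on \<open>[0,1]\<close>, then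
  multiplying the \<open>k\<close>-th coefficient of a power series \<open>F\<close> by \<open>m\<^sub>k\<close> gives \<open>\<integral> F(tw) d\<mu>(t)\<close>, so
  nonnegativity on the half-line \<open>w \<ge> 0\<close> is preserved.  Two kinds of such sequences are needed:

  \<^item> \<open>(p)\<^sub>k / (q)\<^sub>k\<close> with \<open>0 < p \<le> q\<close>, the moments of a Beta distribution
    (\<open>series_pochhammer_ratio\<close>);
  \<^item> \<open>(p)\<^sub>k (q)\<^sub>k / ((p')\<^sub>k (q')\<^sub>k)\<close> with \<open>p + q = p' + q'\<close> and \<open>p \<le> p', q' \<le> q\<close>
    (\<open>series_balanced_ratio\<close>).

  That the second sequence is a moment sequence can be read off Gauss's summation of
  \<open>{}\<^sub>2F\<^sub>1\<close> at 1: with \<open>\<alpha> = q - p'\<close> and \<open>\<beta> = q - q'\<close> it is proportional to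
  \<open>\<Sum>\<^sub>j (\<alpha>)\<^sub>j (\<beta>)\<^sub>j / (j! (q+k)\<^sub>j)\<close>, and \<open>1/(q+k)\<^sub>j\<close> is, up to a factor independent of
  \<open>k\<close>, the Beta sequence \<open>(q)\<^sub>k/(q+j)\<^sub>k\<close>.

  Multiplication by such a sequence adds the numerator parameters \<open>p, q\<close>, or cancels them where
  they are denominator parameters, and adds the more concentrated pair \<open>p', q'\<close> of denominator
  parameters.  From the square of a Bessel function with a suitable index \<open>\<nu>\<close> such steps lead to
  the following edges of the parameter regions:

  \<^item> on the edge \<open>a = b + c/2 + 1/4\<close> take \<open>\<nu> = a - 1/2\<close> (\<open>Omega_coeff_first_edge\<close>);
  \<^item> on the edge \<open>2a = b + 3c/2 + 3/4\<close> take \<open>\<nu> = 2a - c - 1\<close> (\<open>Omega_coeff_second_edge\<close>);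
  \<^item> for \<open>c = a - 1\<close> take \<open>\<nu> = a\<close> (\<open>Omega_coeff_1F2_edge\<close>, \<open>Omega_coeff_1F2_small_a\<close>).

  All other admissible parameters arise from these by increasing \<open>b\<close>, which is again an
  average of Beta type.  Unless it is trivial, each of these averages turns a nonnegative
  function with positive value at 0 into a strictly positive one.  A nontrivial average is
  involved in all cases except \<open>(a, b, c) = (1/2, 1, -1/2)\<close>, where \<open>\<Omega>\<close> is itself a square.
\<close>

section \<open>Power series that are nonnegative on the half-line\<close>

definition entire :: "(nat \<Rightarrow> real) \<Rightarrow> bool" where
  "entire f \<longleftrightarrow> (\<forall>x. summable (\<lambda>k. f k * x ^ k))"

text \<open>
  Positivity of the constant term is what allows an average of a nonnegative function to be
  strictly positive: dilations by small factors see only values close to that term.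
\<close>
definition nonneg_series :: "(nat \<Rightarrow> real) \<Rightarrow> bool" where
  "nonneg_series f \<longleftrightarrow> entire f \<and> f 0 > 0 \<and> (\<forall>x\<ge>0. (\<Sum>k. f k * x ^ k) \<ge> 0)"

definition pos_series :: "(nat \<Rightarrow> real) \<Rightarrow> bool" where
  "pos_series f \<longleftrightarrow> entire f \<and> f 0 > 0 \<and> (\<forall>x\<ge>0. (\<Sum>k. f k * x ^ k) > 0)"

lemma pos_imp_nonneg_series: "pos_series f \<Longrightarrow> nonneg_series f"
  by (auto simp: pos_series_def nonneg_series_def intro: less_imp_le)

lemma entire_summable: "entire f \<Longrightarrow> summable (\<lambda>k. f k * x ^ k)"
  by (simp add: entire_def)

lemma entire_summable_abs:
  assumes "entire f" shows "summable (\<lambda>k. \<bar>f k * x ^ k\<bar>)"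
  using powser_insidea[of f "\<bar>x\<bar> + 1" x] assms by (auto simp: entire_def)

lemma entire_bounded_mult:
  assumes "entire f" and "\<And>k. \<bar>m k\<bar> \<le> (B :: real)"
  shows "entire (\<lambda>k. m k * f k)"
  unfolding entire_def
proof
  fix x :: real
  have "summable (\<lambda>k. B * \<bar>f k * x ^ k\<bar>)"
    by (intro summable_mult entire_summable_abs assms)
  then show "summable (\<lambda>k. m k * f k * x ^ k)"
  proof (rule summable_comparison_test'[of _ 0])
    fix k
    show "norm (m k * f k * x ^ k) \<le> B * \<bar>f k * x ^ k\<bar>"
      using mult_right_mono[OF assms(2)[of k], of "\<bar>f k * x ^ k\<bar>"]
      by (simp add: abs_mult mult.assoc)
  qed
qed

text \<open>
  Dominated convergence for series: a uniform bound on the multipliers suffices, because an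
  everywhere convergent power series converges absolutely.
\<close>
lemma suminf_multiplier_limit:
  fixes m :: "nat \<Rightarrow> nat \<Rightarrow> real"
  assumes f: "entire f" and B: "\<And>n k. \<bar>m n k\<bar> \<le> B"
    and lim: "\<And>k. (\<lambda>n. m n k) \<longlonglongrightarrow> l k"
  shows "(\<lambda>n. \<Sum>k. m n k * f k * x ^ k) \<longlonglongrightarrow> (\<Sum>k. l k * f k * x ^ k)"
proof -
  have "summable (\<lambda>k. B * \<bar>f k * x ^ k\<bar>)"
    by (intro summable_mult entire_summable_abs f)
  moreover have "((\<lambda>n. m n k * f k * x ^ k) \<longlongrightarrow> l k * f k * x ^ k) sequentially" for k
    by (intro tendsto_intros lim)
  moreover have "norm (m n k * f k * x ^ k) \<le> B * \<bar>f k * x ^ k\<bar>" for n k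
    using mult_right_mono[OF B[of n k], of "\<bar>f k * x ^ k\<bar>"] by (simp add: abs_mult mult.assoc)
  then have "\<forall>\<^sub>F (k,n) in sequentially \<times>\<^sub>F sequentially.
      norm (m n k * f k * x ^ k) \<le> B * \<bar>f k * x ^ k\<bar>"
    by (intro always_eventually) auto
  ultimately show ?thesis
    by (intro tannerys_theorem[THEN conjunct2, THEN conjunct2]) auto
qed

lemma nonneg_series_limit:
  fixes m :: "nat \<Rightarrow> nat \<Rightarrow> real"
  assumes f: "entire f" "f 0 > 0" and B: "\<And>n k. \<bar>m n k\<bar> \<le> B"
    and lim: "\<And>k. (\<lambda>n. m n k) \<longlonglongrightarrow> l k" and "l 0 > 0"
    and m: "\<And>n. nonneg_series (\<lambda>k. m n k * f k)"
  shows "nonneg_series (\<lambda>k. l k * f k)"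
proof -
  have "\<bar>l k\<bar> \<le> B" for k
    by (rule tendsto_upperbound[OF tendsto_rabs[OF lim]]) (auto simp: B)
  moreover have "(\<Sum>k. l k * f k * x ^ k) \<ge> 0" if "x \<ge> 0" for x
    by (rule tendsto_lowerbound[OF suminf_multiplier_limit[OF f(1) B lim, where x = x]])
       (use m that in \<open>auto simp: nonneg_series_def\<close>)
  ultimately show ?thesis
    using f \<open>l 0 > 0\<close> by (auto simp: nonneg_series_def intro: entire_bounded_mult)
qed

section \<open>Averages of Beta type with integer parameter difference\<close>

text \<open>
  The new series \<open>G\<close> is the average \<open>q \<integral>\<^sub>0\<^sup>1 t\<^bsup>q-1\<^esup> F(tx) dt\<close> of the given one, \<open>F\<close>.  Instead
  of integrating, one uses the differential equation \<open>(x\<^sup>q G)' = q x\<^bsup>q-1\<^esup> F \<ge> 0\<close>: the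
  function \<open>x\<^sup>q G\<close> is nondecreasing, and near 0 it is positive because \<open>G(0) = F(0) > 0\<close>.
\<close>
lemma pos_series_average:
  assumes f: "nonneg_series f" and q: "q > 0"
  shows "pos_series (\<lambda>k. q / (q + real k) * f k)"
proof -
  define g where "g = (\<lambda>k. q / (q + real k) * f k)"
  have ent: "entire f" and f0: "f 0 > 0" and fpos: "\<And>x. x \<ge> 0 \<Longrightarrow> (\<Sum>k. f k * x ^ k) \<ge> 0"
    using f by (auto simp: nonneg_series_def)
  have g0: "g 0 = f 0" using q by (simp add: g_def)
  have entg: "entire g"
    unfolding g_def by (rule entire_bounded_mult[OF ent, of _ 1]) (use q in auto)
  define G where "G = (\<lambda>x. \<Sum>k. g k * x ^ k)"
  define G' where "G' = (\<lambda>x. \<Sum>k. diffs g k * x ^ k)"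
  have dG: "(G has_real_derivative G' x) (at x)" for x
    unfolding G_def G'_def
    by (rule termdiffs_strong_converges_everywhere) (use entg in \<open>simp add: entire_def\<close>)
  have G0: "G 0 = f 0"
    using suminf_finite[of "{0}" "\<lambda>k. g k * 0 ^ k"] by (simp add: G_def g0)
  have ode: "q * G x + x * G' x = q * (\<Sum>k. f k * x ^ k)" for x
  proof -
    have "(\<lambda>k. diffs g k * x ^ k) sums G' x"
      unfolding G'_def
      by (intro summable_sums termdiff_converges_all) (use entg in \<open>auto simp: entire_def\<close>)
    then have "(\<lambda>k. x * (diffs g k * x ^ k)) sums (x * G' x)"
      by (rule sums_mult)
    then have "(\<lambda>k. real (Suc k) * g (Suc k) * x ^ Suc k) sums (x * G' x)"
      by (simp add: diffs_def mult_ac)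
    then have "(\<lambda>k. real k * g k * x ^ k) sums (x * G' x)"
      by (subst (asm) sums_Suc_iff) auto
    moreover have "(\<lambda>k. q * (g k * x ^ k)) sums (q * G x)"
      unfolding G_def by (intro sums_mult summable_sums entire_summable entg)
    ultimately have "(\<lambda>k. q * (g k * x ^ k) + real k * g k * x ^ k) sums (q * G x + x * G' x)"
      by (intro sums_add)
    also have "(\<lambda>k. q * (g k * x ^ k) + real k * g k * x ^ k) = (\<lambda>k. q * (f k * x ^ k))"
    proof
      fix k
      have "(q + real k) * g k = q * f k"
        using q by (simp add: g_def)
      then show "q * (g k * x ^ k) + real k * g k * x ^ k = q * (f k * x ^ k)"
        by (metis (no_types, opaque_lifting) distrib_right mult.assoc)
    qed
    finally show ?thesis
      using sums_unique2 sums_mult[OF summable_sums[OF entire_summable[OF ent]]] by blast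
  qed
  have "G x > 0" if x: "x \<ge> 0" for x
  proof -
    have "isCont G 0" by (rule DERIV_isCont[OF dG])
    then have "\<forall>\<^sub>F y in at 0. G y > 0"
      unfolding isCont_def G0 using f0 by (rule order_tendstoD)
    then obtain d where d: "d > 0" "\<And>y. y \<noteq> 0 \<Longrightarrow> \<bar>y\<bar> < d \<Longrightarrow> G y > 0"
      by (auto simp: eventually_at dist_norm)
    show ?thesis
    proof (cases "x < d")
      case True
      then show ?thesis using x d(2)[of x] G0 f0 by (cases "x = 0") auto
    next
      case False
      have "(d/2) powr q * G (d/2) \<le> x powr q * G x"
      proof (rule DERIV_nonneg_imp_nondecreasing[where f = "\<lambda>y. y powr q * G y"])
        fix y assume y: "d/2 \<le> y" "y \<le> x"
        then have y0: "y > 0" using d by simp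
        have "((\<lambda>y. y powr q * G y) has_real_derivative
                 y powr (q - 1) * (q * G y + y * G' y)) (at y)"
          using y0 by (auto intro!: derivative_eq_intros dG simp: algebra_simps powr_diff)
        moreover have "y powr (q - 1) * (q * G y + y * G' y) \<ge> 0"
          unfolding ode using y0 q fpos[of y] by simp
        ultimately show "\<exists>D. ((\<lambda>y. y powr q * G y) has_real_derivative D) (at y) \<and> D \<ge> 0"
          by blast
      qed (use False d in simp)
      moreover have "(d/2) powr q * G (d/2) > 0"
        using d by simp
      ultimately have "0 < x powr q * G x" by linarith
      then show ?thesis by (simp add: zero_less_mult_iff)
    qed
  qed
  then show ?thesis
    using entg g0 f0 by (simp add: pos_series_def G_def g_def)
qed

lemma pochhammer_shift_ratio:
  fixes q :: real assumes "q > 0"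
  shows "pochhammer q k / pochhammer (q + real j) k = pochhammer q j / pochhammer (q + real k) j"
proof -
  have "pochhammer q k * pochhammer (q + real k) j = pochhammer q j * pochhammer (q + real j) k"
    by (metis add.commute pochhammer_product')
  moreover have "pochhammer (q + real k) j > 0" "pochhammer (q + real j) k > 0"
    using assms by (auto intro!: pochhammer_pos)
  ultimately show ?thesis by (simp add: field_simps)
qed

lemma pochhammer_Suc_ratio:
  fixes q :: real assumes "q > 0"
  shows "pochhammer q k / pochhammer (q + 1) k = q / (q + real k)"
  using pochhammer_shift_ratio[OF assms, of k 1] by simp

lemma nonneg_series_average_nat:
  assumes f: "nonneg_series f" and q: "q > 0"
  shows "nonneg_series (\<lambda>k. pochhammer q k / pochhammer (q + real j) k * f k)"
proof (induction j)
  case 0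
  have "pochhammer q k \<noteq> 0" for k using pochhammer_pos[OF q, of k] by simp
  then show ?case using f by simp
next
  case (Suc j)
  have q': "q + real j > 0" using q by simp
  have *: "pochhammer q k / pochhammer (q + real (Suc j)) k * f k = 
     (q + real j) / (q + real j + real k) * (pochhammer q k / pochhammer (q + real j) k * f k)" for k
  proof -
    have "pochhammer (q + real j) k > 0" "pochhammer (q + real j + 1) k > 0"
      using q by (auto intro!: pochhammer_pos)
    then show ?thesis
      unfolding pochhammer_Suc_ratio[OF q', symmetric] by (simp add: field_simps)
  qed
  show ?case
    unfolding * using pos_series_average[OF Suc q'] by (rule pos_imp_nonneg_series)
qed

section \<open>Gauss's hypergeometric sum at 1\<close>

text \<open>The terms of \<open>{}\<^sub>2F\<^sub>1(\<alpha>, \<beta>; r; 1)\<close>.\<close>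
definition gauss_term :: "real \<Rightarrow> real \<Rightarrow> real \<Rightarrow> nat \<Rightarrow> real" where
  "gauss_term \<alpha> \<beta> r j = pochhammer \<alpha> j * pochhammer \<beta> j / (fact j * pochhammer r j)"

lemma gauss_term_nonneg:
  "\<alpha> \<ge> 0 \<Longrightarrow> \<beta> \<ge> 0 \<Longrightarrow> r > 0 \<Longrightarrow> gauss_term \<alpha> \<beta> r j \<ge> 0"
  unfolding gauss_term_def
  by (intro divide_nonneg_pos mult_nonneg_nonneg mult_pos_pos)
     (auto simp: pochhammer_prod intro: prod_nonneg prod_pos)

text \<open>
  Both expressions are, up to the factor \<open>r\<close>, the forward difference of \<open>j t\<^sub>j\<close>.  The first
  identity controls the decay of \<open>t\<^sub>j\<close>; the second, once summed over \<open>j\<close>, is the contiguous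
  relation between the sums with parameters \<open>r\<close> and \<open>r + 1\<close>.
\<close>
lemma gauss_term_telescope:
  assumes r: "r > 0"
  shows "gauss_term \<alpha> \<beta> r j * (\<alpha> * \<beta> - real j * (r - \<alpha> - \<beta>)) / (r + real j) =
           real (Suc j) * gauss_term \<alpha> \<beta> r (Suc j) - real j * gauss_term \<alpha> \<beta> r j"
    and "(r - \<alpha>) * (r - \<beta>) * gauss_term \<alpha> \<beta> (r + 1) j - r * (r - \<alpha> - \<beta>) * gauss_term \<alpha> \<beta> r j =
           r * (gauss_term \<alpha> \<beta> r j * (\<alpha> * \<beta> - real j * (r - \<alpha> - \<beta>)) / (r + real j))"
proof -
  define P where "P = pochhammer r j"
  have P: "P > 0" and rj: "r + real j > 0" using r by (auto simp: P_def intro!: pochhammer_pos)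
  have j1: "gauss_term \<alpha> \<beta> r (Suc j) * real (Suc j) =
      gauss_term \<alpha> \<beta> r j * ((\<alpha> + real j) * (\<beta> + real j) / (r + real j))"
    using rj P unfolding gauss_term_def pochhammer_Suc fact_Suc P_def[symmetric]
    by (simp add: divide_simps)
  show "gauss_term \<alpha> \<beta> r j * (\<alpha> * \<beta> - real j * (r - \<alpha> - \<beta>)) / (r + real j) =
           real (Suc j) * gauss_term \<alpha> \<beta> r (Suc j) - real j * gauss_term \<alpha> \<beta> r j"
    unfolding mult.commute[of "real (Suc j)"] j1 using rj by (simp add: field_simps)
  have "r * pochhammer (r + 1) j = P * (r + real j)"
    unfolding P_def by (metis pochhammer_Suc pochhammer_rec)
  then have "pochhammer (r + 1) j = P * (r + real j) / r"
    using r by (simp add: field_simps)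
  then have "gauss_term \<alpha> \<beta> (r + 1) j = gauss_term \<alpha> \<beta> r j * r / (r + real j)"
    by (simp add: gauss_term_def P_def[symmetric])
  then show "(r - \<alpha>) * (r - \<beta>) * gauss_term \<alpha> \<beta> (r + 1) j - r * (r - \<alpha> - \<beta>) * gauss_term \<alpha> \<beta> r j =
           r * (gauss_term \<alpha> \<beta> r j * (\<alpha> * \<beta> - real j * (r - \<alpha> - \<beta>)) / (r + real j))"
    using rj by (simp add: divide_simps) (simp add: algebra_simps)
qed

text \<open>
  By the first telescoping identity \<open>u\<^sub>j = j t\<^sub>j\<close> eventually decreases by at least
  \<open>(r - \<alpha> - \<beta>)/2 * t\<^sub>j\<close> in each step.  As \<open>u\<^sub>j \<ge> 0\<close>, the \<open>t\<^sub>j\<close> are summable and \<open>u\<^sub>j\<close>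
  converges; its limit is 0, since otherwise \<open>t\<^sub>j\<close> would dominate a harmonic series.
\<close>
lemma summable_gauss_term:
  assumes ab: "\<alpha> \<ge> 0" "\<beta> \<ge> 0" and s: "r - \<alpha> - \<beta> > 0"
  shows "summable (gauss_term \<alpha> \<beta> r)" and "(\<lambda>j. real j * gauss_term \<alpha> \<beta> r j) \<longlonglongrightarrow> 0"
proof -
  define t where "t = gauss_term \<alpha> \<beta> r"
  define s where "s = r - \<alpha> - \<beta>"
  define u where "u = (\<lambda>j. real j * t j)"
  have r: "r > 0" and s0: "s > 0" using assms by (auto simp: s_def)
  have t0: "t j \<ge> 0" for j using gauss_term_nonneg[OF ab r] by (simp add: t_def)
  have "\<forall>\<^sub>F j in sequentially. (real j * s - \<alpha> * \<beta>) / (r + real j) > s / 2"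
  proof (rule order_tendstoD)
    show "(\<lambda>j. (real j * s - \<alpha> * \<beta>) / (r + real j)) \<longlonglongrightarrow> s" by real_asymp
  qed (use s0 in simp)
  then obtain N where N: "\<And>j. j \<ge> N \<Longrightarrow> (real j * s - \<alpha> * \<beta>) / (r + real j) > s / 2"
    by (auto simp: eventually_sequentially)
  have dec: "u j - u (Suc j) \<ge> s / 2 * t j" if "j \<ge> N" for j
  proof -
    have "u j - u (Suc j) = t j * ((real j * s - \<alpha> * \<beta>) / (r + real j))"
      using gauss_term_telescope(1)[OF r, of \<alpha> \<beta> j] 
      by (simp add: u_def t_def s_def diff_divide_distrib right_diff_distrib)
    moreover have "t j * (s / 2) \<le> t j * ((real j * s - \<alpha> * \<beta>) / (r + real j))"
      using N[OF that] t0 by (intro mult_left_mono) auto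
    ultimately show ?thesis by (simp add: mult.commute)
  qed
  have "convergent (\<lambda>j. u (j + N))"
  proof (rule Bseq_monoseq_convergent)
    have mono: "decseq (\<lambda>j. u (j + N))"
      using dec s0 t0 by (intro decseq_SucI) (smt (verit) add_Suc le_add2 mult_nonneg_nonneg half_gt_zero)
    then show "monoseq (\<lambda>j. u (j + N))" by (simp add: decseq_imp_monoseq)
    show "Bseq (\<lambda>j. u (j + N))"
    proof (rule BseqI')
      fix j show "norm (u (j + N)) \<le> u N"
        using decseqD[OF mono, of 0 j] t0 by (simp add: u_def)
    qed
  qed
  then obtain L where L': "(\<lambda>j. u (j + N)) \<longlonglongrightarrow> L" by (auto simp: convergent_def)
  then have L: "u \<longlonglongrightarrow> L" by (rule LIMSEQ_offset)
  have "summable (\<lambda>j. u j - u (Suc j))"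
    by (rule telescope_summable'[OF L])
  then have "summable (\<lambda>j. 2 / s * (u j - u (Suc j)))" by (rule summable_mult)
  then have sm: "summable t"
  proof (rule summable_comparison_test'[of _ N])
    fix j assume "j \<ge> N"
    from dec[OF this] show "norm (t j) \<le> 2 / s * (u j - u (Suc j))"
      using s0 t0[of j] by (simp add: field_simps)
  qed
  then show "summable (gauss_term \<alpha> \<beta> r)" by (simp add: t_def)
  have "L \<ge> 0" by (rule tendsto_lowerbound[OF L]) (auto simp: u_def t0)
  moreover have "\<not> L > 0"
  proof
    assume "L > 0"
    then have "\<forall>\<^sub>F j in sequentially. u j > L / 2" by (intro order_tendstoD[OF L]) auto
    then obtain M where M: "\<And>j. j \<ge> M \<Longrightarrow> u j > L / 2" by (auto simp: eventually_sequentially)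
    have "summable (\<lambda>j. 2 / L * t j)" using sm by (rule summable_mult)
    then have "summable (\<lambda>j. inverse (real j))"
    proof (rule summable_comparison_test'[of _ "Suc M"])
      fix j assume "j \<ge> Suc M"
      then show "norm (inverse (real j)) \<le> 2 / L * t j"
        using M[of j] \<open>L > 0\<close> by (simp add: u_def field_simps)
    qed
    then show False using not_summable_harmonic[where 'a = real] by simp
  qed
  ultimately have "L = 0" by simp
  then show "(\<lambda>j. real j * gauss_term \<alpha> \<beta> r j) \<longlonglongrightarrow> 0"
    using L by (simp add: u_def[abs_def] t_def)
qed

lemma gauss_contiguous:
  assumes ab: "\<alpha> \<ge> 0" "\<beta> \<ge> 0" and s: "r - \<alpha> - \<beta> > 0"
  shows "(r - \<alpha>) * (r - \<beta>) * suminf (gauss_term \<alpha> \<beta> (r + 1)) =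
         r * (r - \<alpha> - \<beta>) * suminf (gauss_term \<alpha> \<beta> r)"
proof -
  have r: "r > 0" using assms by simp
  note sm = summable_gauss_term[OF ab]
  have "(\<lambda>j. (r - \<alpha>) * (r - \<beta>) * gauss_term \<alpha> \<beta> (r + 1) j - r * (r - \<alpha> - \<beta>) * gauss_term \<alpha> \<beta> r j)
      sums ((r - \<alpha>) * (r - \<beta>) * suminf (gauss_term \<alpha> \<beta> (r + 1)) -
            r * (r - \<alpha> - \<beta>) * suminf (gauss_term \<alpha> \<beta> r))"
    using s by (intro sums_diff sums_mult summable_sums sm) auto
  moreover have "(\<lambda>j. r * (real (Suc j) * gauss_term \<alpha> \<beta> r (Suc j) - real j * gauss_term \<alpha> \<beta> r j))
      sums (r * (0 - real 0 * gauss_term \<alpha> \<beta> r 0))"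
    by (intro sums_mult telescope_sums sm(2) s)
  ultimately show ?thesis
    unfolding gauss_term_telescope(2)[OF r] gauss_term_telescope(1)[OF r]
    by (auto dest: sums_unique2)
qed

section \<open>Averages coming from Gauss's sum\<close>

definition balanced_ratio :: "real \<Rightarrow> real \<Rightarrow> real \<Rightarrow> real \<Rightarrow> nat \<Rightarrow> real" where
  "balanced_ratio p q p' q' k =
     pochhammer p k * pochhammer q k / (pochhammer p' k * pochhammer q' k)"

lemma balanced_ratio_bounds:
  assumes "0 < p" "p \<le> p'" "p \<le> q'" "p + q = p' + q'"
  shows "0 < balanced_ratio p q p' q' k" and "balanced_ratio p q p' q' k \<le> 1"
proof -
  have pos: "pochhammer p k > 0" "pochhammer q k > 0" "pochhammer p' k > 0" "pochhammer q' k > 0" for k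
    using assms by (auto intro!: pochhammer_pos)
  then show "0 < balanced_ratio p q p' q' k" by (simp add: balanced_ratio_def)
  have "pochhammer p k * pochhammer q k \<le> pochhammer p' k * pochhammer q' k"
  proof (induction k)
    case (Suc k)
    have q: "q = p' + q' - p" using assms by simp
    have "(p' - p) * (q' - p) \<ge> 0" using assms by simp
    then have "(p + real k) * (q + real k) \<le> (p' + real k) * (q' + real k)"
      unfolding q by (simp add: algebra_simps)
    moreover have "(p + real k) * (q + real k) \<ge> 0" using assms by simp
    ultimately have "(pochhammer p k * pochhammer q k) * ((p + real k) * (q + real k)) \<le>
        (pochhammer p' k * pochhammer q' k) * ((p' + real k) * (q' + real k))"
      using pos[of k] by (intro mult_mono[OF Suc]) (auto intro!: mult_nonneg_nonneg less_imp_le)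
    then show ?case by (simp add: pochhammer_Suc mult_ac)
  qed simp
  then show "balanced_ratio p q p' q' k \<le> 1"
    using pos[of k] by (simp add: balanced_ratio_def)
qed

text \<open>
  Gauss's summation formula up to the normalising constant.  The contiguous relation alone
  determines the dependence on \<open>k\<close>, so no Gamma function has to be evaluated.
\<close>
lemma suminf_gauss_term_shift:
  assumes "0 < p" "p' \<le> q" "q' \<le> q" "p + q = p' + q'"
  shows "suminf (gauss_term (q - p') (q - q') (q + real k)) =
         balanced_ratio p q p' q' k * suminf (gauss_term (q - p') (q - q') q)"
proof (induction k)
  case (Suc k)
  define S where "S = (\<lambda>r. suminf (gauss_term (q - p') (q - q') r))"
  have p': "p' > 0" "q' > 0" using assms by auto
  have pos: "pochhammer p' k > 0" "pochhammer q' k > 0" using p' by (auto intro!: pochhammer_pos)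
  have q: "q = p' + q' - p" using assms by simp
  have "(p' + real k) * (q' + real k) * S (q + real k + 1) = (q + real k) * (p + real k) * S (q + real k)"
    using gauss_contiguous[of "q - p'" "q - q'" "q + real k"] assms
    by (simp add: S_def algebra_simps q)
  also have "S (q + real k) = balanced_ratio p q p' q' k * S q"
    using Suc by (simp add: S_def)
  finally have step: "(p' + real k) * (q' + real k) * S (q + real k + 1) =
      (q + real k) * (p + real k) * (balanced_ratio p q p' q' k * S q)" .
  have pk: "p' + real k > 0" "q' + real k > 0" using p' by auto
  have "S (q + real k + 1) = (q + real k) * (p + real k) * (balanced_ratio p q p' q' k * S q) /
      ((p' + real k) * (q' + real k))"
    unfolding step[symmetric] using pk by simp
  then have "S (q + real k + 1) = balanced_ratio p q p' q' (Suc k) * S q"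
    by (simp add: balanced_ratio_def pochhammer_Suc mult_ac)
  then show ?case by (simp add: S_def add_ac)
qed (simp add: balanced_ratio_def)

text \<open>
  Up to the constant \<open>\<Sum>\<^sub>j w\<^sub>j\<close>, the new series is the combination \<open>\<Sum>\<^sub>j w\<^sub>j F\<^sub>j\<close> of the averages
  \<open>F\<^sub>j\<close> with multipliers \<open>(q)\<^sub>k/(q+j)\<^sub>k\<close>, where the weights \<open>w\<^sub>j \<ge> 0\<close> are the terms of Gauss's
  sum.  Here \<open>F\<^sub>0\<close> is the original series, which may have zeros; strict positivity comes from
  \<open>w\<^sub>1 F\<^sub>1\<close>, and \<open>w\<^sub>1 = \<alpha>\<beta>/q\<close> is positive exactly when the pair \<open>p', q'\<close> differs from the
  pair \<open>p, q\<close>.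
\<close>
lemma series_balanced_ratio:
  assumes f: "nonneg_series f" and pq: "0 < p" "p \<le> p'" "p \<le> q'" "p + q = p' + q'"
  shows "nonneg_series (\<lambda>k. balanced_ratio p q p' q' k * f k)"
    and "p < p' \<Longrightarrow> p < q' \<Longrightarrow> pos_series (\<lambda>k. balanced_ratio p q p' q' k * f k)"
proof -
  define \<alpha> where "\<alpha> = q - p'"
  define \<beta> where "\<beta> = q - q'"
  have ab: "\<alpha> \<ge> 0" "\<beta> \<ge> 0" and q: "q > 0" and s: "q - \<alpha> - \<beta> > 0"
    using pq by (auto simp: \<alpha>_def \<beta>_def)
  have ent: "entire f" and f0: "f 0 > 0" using f by (auto simp: nonneg_series_def)
  define m where "m = balanced_ratio p q p' q'"
  have m0: "m 0 = 1" by (simp add: m_def balanced_ratio_def)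
  have entm: "entire (\<lambda>k. m k * f k)"
  proof (rule entire_bounded_mult[OF ent])
    show "\<bar>m k\<bar> \<le> 1" for k
      using balanced_ratio_bounds[OF pq, of k] by (simp add: m_def)
  qed
  define w where "w = gauss_term \<alpha> \<beta> q"
  define v where "v = (\<lambda>j k. pochhammer q k / pochhammer (q + real j) k)"
  have w0: "w j \<ge> 0" for j using gauss_term_nonneg[OF ab q] by (simp add: w_def)
  have smw: "summable w" using summable_gauss_term[OF ab s] by (simp add: w_def)
  have v: "0 \<le> v j k" "v j k \<le> 1" for j k
  proof -
    have "pochhammer q k \<le> pochhammer (q + real j) k"
      using q unfolding pochhammer_prod by (intro prod_mono) auto
    moreover have "pochhammer q k > 0" "pochhammer (q + real j) k > 0"
      using q by (auto intro!: pochhammer_pos)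
    ultimately show "0 \<le> v j k" "v j k \<le> 1" by (auto simp: v_def)
  qed
  have wv: "w j * v j k = gauss_term \<alpha> \<beta> (q + real k) j" for j k
  proof -
    have "pochhammer q j > 0" using q by (rule pochhammer_pos)
    then show ?thesis
      unfolding v_def pochhammer_shift_ratio[OF q] w_def gauss_term_def by simp
  qed
  have mS: "(\<lambda>J. \<Sum>j<J. w j * v j k) \<longlonglongrightarrow> m k * suminf w" for k
  proof -
    have "summable (\<lambda>j. w j * v j k)"
      unfolding wv using s by (intro summable_gauss_term ab) simp
    moreover have "suminf (\<lambda>j. w j * v j k) = m k * suminf w"
      unfolding wv unfolding m_def w_def \<alpha>_def \<beta>_def using pq by (intro suminf_gauss_term_shift) auto
    ultimately show ?thesis using summable_LIMSEQ by force
  qed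
  have "w 0 = 1" by (simp add: w_def gauss_term_def)
  then have Spos: "suminf w > 0"
    using suminf_pos2[OF smw w0, of 0] by simp
  have bnd: "\<bar>\<Sum>j<J. w j * v j k\<bar> \<le> suminf w" for J k
  proof -
    have "(\<Sum>j<J. w j * v j k) \<le> (\<Sum>j<J. w j)"
      using v w0 by (intro sum_mono) (simp add: mult_left_le)
    also have "\<dots> \<le> suminf w" using smw w0 by (intro sum_le_suminf) auto
    finally show ?thesis using v w0 by (simp add: sum_nonneg)
  qed
  define F where "F = (\<lambda>j x. \<Sum>k. v j k * f k * x ^ k)"
  have smF: "summable (\<lambda>k. v j k * f k * x ^ k)" for j x
    using entire_bounded_mult[OF ent, of "v j" 1] v by (auto simp: entire_def)
  have F0: "F j x \<ge> 0" if "x \<ge> 0" for j x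
    using nonneg_series_average_nat[OF f q, of j] that by (simp add: nonneg_series_def F_def v_def)
  have F1: "F 1 x > 0" if "x \<ge> 0" for x
  proof -
    have "v 1 k = q / (q + real k)" for k
      using pochhammer_Suc_ratio[OF q] by (simp add: v_def)
    then show ?thesis
      using pos_series_average[OF f q] that unfolding F_def pos_series_def by presburger
  qed
  have lim: "(\<lambda>J. \<Sum>j<J. w j * F j x) \<longlonglongrightarrow> suminf w * (\<Sum>k. m k * f k * x ^ k)" for x
  proof -
    have "(\<lambda>J. \<Sum>k. (\<Sum>j<J. w j * v j k) * f k * x ^ k) \<longlonglongrightarrow> (\<Sum>k. (m k * suminf w) * f k * x ^ k)"
      by (rule suminf_multiplier_limit[OF ent bnd mS])
    moreover have "(\<Sum>k. (\<Sum>j<J. w j * v j k) * f k * x ^ k) = (\<Sum>j<J. w j * F j x)" for J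
    proof -
      have "(\<Sum>j<J. w j * F j x) = (\<Sum>j<J. \<Sum>k. w j * (v j k * f k * x ^ k))"
        unfolding F_def by (intro sum.cong refl suminf_mult[symmetric] smF)
      also have "\<dots> = (\<Sum>k. \<Sum>j<J. w j * (v j k * f k * x ^ k))"
        by (intro suminf_sum[symmetric] summable_mult smF)
      also have "\<dots> = (\<Sum>k. (\<Sum>j<J. w j * v j k) * f k * x ^ k)"
        by (simp add: sum_distrib_right mult.assoc)
      finally show ?thesis ..
    qed
    moreover have "(\<Sum>k. (m k * suminf w) * f k * x ^ k) = suminf w * (\<Sum>k. m k * f k * x ^ k)"
      using entm by (subst suminf_mult[symmetric]) (auto simp: entire_def mult_ac)
    ultimately show ?thesis by simp
  qed
  have "(\<Sum>k. m k * f k * x ^ k) \<ge> 0" if "x \<ge> 0" for x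
  proof -
    have "suminf w * (\<Sum>k. m k * f k * x ^ k) \<ge> 0"
      by (rule tendsto_lowerbound[OF lim]) (auto intro!: always_eventually sum_nonneg mult_nonneg_nonneg w0 F0 that)
    then show ?thesis using Spos by (simp add: zero_le_mult_iff)
  qed
  then show "nonneg_series (\<lambda>k. balanced_ratio p q p' q' k * f k)"
    using entm m0 f0 by (simp add: nonneg_series_def m_def)
  assume "p < p'" "p < q'"
  then have "\<alpha> > 0" "\<beta> > 0" using pq by (auto simp: \<alpha>_def \<beta>_def)
  then have w1: "w 1 > 0" using q by (simp add: w_def gauss_term_def)
  have "(\<Sum>k. m k * f k * x ^ k) > 0" if x: "x \<ge> 0" for x
  proof -
    have "suminf w * (\<Sum>k. m k * f k * x ^ k) \<ge> w 1 * F 1 x"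
    proof (rule tendsto_lowerbound[OF lim])
      show "\<forall>\<^sub>F J in sequentially. w 1 * F 1 x \<le> (\<Sum>j<J. w j * F j x)"
        using eventually_gt_at_top[of 1]
        by eventually_elim (rule member_le_sum, auto intro!: mult_nonneg_nonneg w0 F0 x)
    qed auto
    moreover have "w 1 * F 1 x > 0" using w1 F1[OF x] by simp
    ultimately have "0 < suminf w * (\<Sum>k. m k * f k * x ^ k)" by linarith
    then show ?thesis using Spos by (simp add: zero_less_mult_iff)
  qed
  then show "pos_series (\<lambda>k. balanced_ratio p q p' q' k * f k)"
    using entm m0 f0 by (simp add: pos_series_def m_def)
qed

text \<open>
  A Beta average is a limit of the preceding averages: replacing the pair \<open>p, q + n\<close> by
  \<open>q, p + n\<close> gives the multiplier \<open>(p)\<^sub>k/(q)\<^sub>k * (q+n)\<^sub>k/(p+n)\<^sub>k\<close>, whose second factor tends to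
  1.  Strictness does not survive the limit; it is recovered by first averaging with
  \<open>(p+1)\<^sub>k/(q+1)\<^sub>k\<close> and then replacing \<open>p, q + 1\<close> by \<open>q, p + 1\<close>.
\<close>
lemma series_pochhammer_ratio:
  assumes f: "nonneg_series f" and pq: "0 < p" "p \<le> q"
  shows "nonneg_series (\<lambda>k. pochhammer p k / pochhammer q k * f k)"
    and "p < q \<Longrightarrow> pos_series (\<lambda>k. pochhammer p k / pochhammer q k * f k)"
proof -
  have gen: "nonneg_series (\<lambda>k. pochhammer p k / pochhammer q k * f k)" if pq: "0 < p" "p \<le> q" for p q
  proof (rule nonneg_series_limit)
    show "entire f" "f 0 > 0" using f by (auto simp: nonneg_series_def)
    let ?m = "\<lambda>n. balanced_ratio p (q + real n) q (p + real n)"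
    show "\<bar>?m n k\<bar> \<le> 1" for n k
      using balanced_ratio_bounds[of p q "p + real n" "q + real n" k] pq by simp
    show "nonneg_series (\<lambda>k. ?m n k * f k)" for n
      by (rule series_balanced_ratio[OF f]) (use pq in auto)
    show "(\<lambda>n. ?m n k) \<longlonglongrightarrow> pochhammer p k / pochhammer q k" for k
    proof -
      have one: "(\<lambda>n. pochhammer (q + real n) k / pochhammer (p + real n) k) \<longlonglongrightarrow> 1"
      proof (induction k)
        case (Suc k)
        have "(\<lambda>n. (q + real n + real k) / (p + real n + real k)) \<longlonglongrightarrow> 1" by real_asymp
        from tendsto_mult[OF Suc this] show ?case by (simp add: pochhammer_Suc)
      qed simp
      have "?m n k = pochhammer p k / pochhammer q k * (pochhammer (q + real n) k / pochhammer (p + real n) k)" for n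
        by (simp add: balanced_ratio_def)
      then show ?thesis using tendsto_mult[OF tendsto_const[of "pochhammer p k / pochhammer q k"] one] by simp
    qed
  qed simp
  show "nonneg_series (\<lambda>k. pochhammer p k / pochhammer q k * f k)"
    by (rule gen[OF pq])
  assume "p < q"
  have "pos_series (\<lambda>k. balanced_ratio p (q + 1) q (p + 1) k *
           (pochhammer (p + 1) k / pochhammer (q + 1) k * f k))"
    by (rule series_balanced_ratio[OF gen]) (use pq \<open>p < q\<close> in auto)
  moreover have "pochhammer (p + 1) k \<noteq> 0" "pochhammer (q + 1) k \<noteq> 0" for k
    using pochhammer_pos[of "p + 1" k] pochhammer_pos[of "q + 1" k] pq by auto
  ultimately show "pos_series (\<lambda>k. pochhammer p k / pochhammer q k * f k)"
    by (simp add: balanced_ratio_def)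
qed

section \<open>The square of a Bessel function\<close>

lemma pochhammer_half_double:
  fixes z :: real
  shows "pochhammer (2 * z + 1 + real k) k * pochhammer (2 * z + 1) k = 4 ^ k * (pochhammer (z + 1/2) k * pochhammer (z + 1) k)"
proof -
  have "pochhammer (2 * z + 1) k * pochhammer (2 * z + 1 + real k) k = pochhammer (2 * z + 1) (2 * k)"
    using pochhammer_product'[of "2 * z + 1" k k] by (simp only: mult_2[of k])
  also have "\<dots> = of_nat (2 ^ (2 * k)) * pochhammer (z + 1/2) k * pochhammer (z + 1/2 + 1/2) k"
  proof -
    have "2 * (z + 1/2) = 2 * z + 1" by simp
    then show ?thesis using pochhammer_double[of "z + 1/2" k] by metis
  qed
  also have "of_nat (2 ^ (2 * k)) = (4 ^ k :: real)" by (simp add: power_mult)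
  also have "z + 1/2 + 1/2 = z + 1" by simp
  finally show ?thesis by (simp only: mult_ac)
qed

text \<open>
  After multiplication by \<open>((\<nu>+1)\<^sub>k)\<^sup>2\<close> the summands become products of the binomial
  coefficients of \<open>\<nu> + k\<close> over \<open>i\<close> and over \<open>k - i\<close>, and Vandermonde's identity applies.
\<close>
lemma bessel_square_coeff:
  fixes \<nu> :: real
  assumes "\<nu> > -1/2"
  shows "(\<Sum>i\<le>k. 1 / (pochhammer (\<nu> + 1) i * fact i) * (1 / (pochhammer (\<nu> + 1) (k - i) * fact (k - i)))) =
     4 ^ k * pochhammer (\<nu> + 1/2) k / (pochhammer (\<nu> + 1) k * pochhammer (2 * \<nu> + 1) k * fact k)"
proof -
  let ?P = "pochhammer (\<nu> + 1) k"
  have P: "pochhammer (\<nu> + 1) j > 0" for j using assms by (intro pochhammer_pos) auto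
  have P2: "pochhammer (2 * \<nu> + 1) j > 0" for j using assms by (intro pochhammer_pos) auto
  have bin: "(\<nu> + real k) gchoose (k - i) = ?P / (pochhammer (\<nu> + 1) i * fact (k - i))" if "i \<le> k" for i
  proof -
    have "?P = pochhammer (\<nu> + 1) i * pochhammer (\<nu> + 1 + real i) (k - i)"
      using pochhammer_product[OF that, of "\<nu> + 1"] by simp
    then show ?thesis using that P[of i]
      by (simp add: gbinomial_pochhammer' of_nat_diff add_ac)
  qed
  have "(\<Sum>i\<le>k. 1 / (pochhammer (\<nu> + 1) i * fact i) * (1 / (pochhammer (\<nu> + 1) (k - i) * fact (k - i)))) * ?P\<^sup>2
     = (\<Sum>i\<le>k. ((\<nu> + real k) gchoose i) * ((\<nu> + real k) gchoose (k - i)))"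
    unfolding sum_distrib_right
  proof (rule sum.cong)
    fix i assume "i \<in> {..k}"
    then have i: "i \<le> k" by simp
    have "(\<nu> + real k) gchoose i = ?P / (pochhammer (\<nu> + 1) (k - i) * fact i)"
      using bin[of "k - i"] i by simp
    then show "1 / (pochhammer (\<nu> + 1) i * fact i) * (1 / (pochhammer (\<nu> + 1) (k - i) * fact (k - i))) * ?P\<^sup>2
      = ((\<nu> + real k) gchoose i) * ((\<nu> + real k) gchoose (k - i))"
      by (simp add: bin[OF i] power2_eq_square)
  qed simp
  also have "\<dots> = (\<nu> + real k + (\<nu> + real k)) gchoose k"
    using gbinomial_Vandermonde[of "\<nu> + real k" "\<nu> + real k" k] by (simp add: atLeast0AtMost)
  also have "\<dots> = pochhammer (2 * \<nu> + 1 + real k) k / fact k"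
    by (simp add: gbinomial_pochhammer' algebra_simps)
  also have "pochhammer (2 * \<nu> + 1 + real k) k = 4 ^ k * (pochhammer (\<nu> + 1/2) k * ?P) / pochhammer (2 * \<nu> + 1) k"
    using pochhammer_half_double[of \<nu> k] P2[of k] by (simp add: field_simps)
  finally show ?thesis
    using P[of k] P2[of k] by (simp add: field_simps power2_eq_square)
qed

lemma entire_bessel:
  assumes "\<mu> > 0"
  shows "entire (\<lambda>k. c ^ k / (pochhammer \<mu> k * fact k))"
  unfolding entire_def
proof
  fix x :: real
  show "summable (\<lambda>k. c ^ k / (pochhammer \<mu> k * fact k) * x ^ k)" (is "summable ?f")
  proof -
    define r where "r = (\<lambda>n. c * x / ((\<mu> + real n) * (1 + real n)))"
    have step: "?f (Suc n) = r n * ?f n" for n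
      by (simp add: r_def pochhammer_Suc mult_ac)
    have "r \<longlonglongrightarrow> 0"
      unfolding r_def by real_asymp
    then have "eventually (\<lambda>n. norm (r n) < 1/2) sequentially"
      by (auto simp: tendsto_iff dist_norm elim!: allE[of _ "1/2"])
    then obtain N where N: "\<And>n. n \<ge> N \<Longrightarrow> norm (r n) < 1/2"
      by (auto simp: eventually_sequentially)
    show ?thesis
    proof (rule summable_ratio_test)
      show "norm (?f (Suc n)) \<le> 1/2 * norm (?f n)" if "n \<ge> N" for n
        unfolding step norm_mult[of "r n"] using N[OF that] by (intro mult_right_mono) auto
    qed simp
  qed
qed

text \<open>
  The coefficients of \<open>{}\<^sub>1F\<^sub>2(\<nu>+1/2; \<nu>+1, 2\<nu>+1; -w)\<close>, which for \<open>w = x\<^sup>2/4\<close> is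
  \<open>\<Gamma>(\<nu>+1)\<^sup>2 (x/4)\<^bsup>-2\<nu>\<^esup> J\<^sub>\<nu>(x/2)\<^sup>2\<close>.
\<close>
definition bessel_square :: "real \<Rightarrow> nat \<Rightarrow> real" where
  "bessel_square \<nu> k = (-1) ^ k * pochhammer (\<nu> + 1/2) k /
     (pochhammer (\<nu> + 1) k * pochhammer (2 * \<nu> + 1) k * fact k)"

lemma nonneg_series_bessel_square:
  assumes nu: "\<nu> > -1/2"
  shows "nonneg_series (bessel_square \<nu>)"
proof -
  define j where "j = (\<lambda>k. (-1/4) ^ k / (pochhammer (\<nu> + 1) k * fact k) :: real)"
  have ent: "entire j" unfolding j_def using nu by (intro entire_bessel) auto
  have coeff: "(\<Sum>i\<le>k. j i * j (k - i)) = bessel_square \<nu> k" for k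
  proof -
    have "(\<Sum>i\<le>k. j i * j (k - i)) = (-1/4) ^ k * (\<Sum>i\<le>k. 1 / (pochhammer (\<nu> + 1) i * fact i) * (1 / (pochhammer (\<nu> + 1) (k - i) * fact (k - i))))"
      unfolding sum_distrib_left
    proof (rule sum.cong)
      fix i assume "i \<in> {..k}"
      then have "(-1/4 :: real) ^ k = (-1/4) ^ i * (-1/4) ^ (k - i)"
        by (simp flip: power_add)
      then show "j i * j (k - i) = (-1/4) ^ k * (1 / (pochhammer (\<nu> + 1) i * fact i) * (1 / (pochhammer (\<nu> + 1) (k - i) * fact (k - i))))"
        by (simp add: j_def)
    qed simp
    also have "\<dots> = bessel_square \<nu> k"
      unfolding bessel_square_coeff[OF nu] bessel_square_def by (simp add: mult_ac flip: power_mult_distrib)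
    finally show ?thesis .
  qed
  have sums: "(\<lambda>k. bessel_square \<nu> k * x ^ k) sums (\<Sum>k. j k * x ^ k)\<^sup>2" for x
  proof -
    have "(\<lambda>k. \<Sum>i\<le>k. (j i * x ^ i) * (j (k - i) * x ^ (k - i))) sums
       ((\<Sum>k. j k * x ^ k) * (\<Sum>k. j k * x ^ k))"
      using entire_summable_abs[OF ent, of x] by (intro Cauchy_product_sums) auto
    moreover have "(\<Sum>i\<le>k. (j i * x ^ i) * (j (k - i) * x ^ (k - i))) = bessel_square \<nu> k * x ^ k" for k
      unfolding coeff[symmetric] sum_distrib_right
      by (rule sum.cong) (auto simp: mult_ac simp flip: power_add)
    ultimately show ?thesis by (simp add: power2_eq_square)
  qed
  show ?thesis
    unfolding nonneg_series_def entire_def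
  proof (intro conjI allI impI)
    show "summable (\<lambda>k. bessel_square \<nu> k * x ^ k)" for x
      using sums_summable[OF sums] .
    show "(\<Sum>k. bessel_square \<nu> k * x ^ k) \<ge> 0" for x
      unfolding sums_unique[OF sums, symmetric] by simp
  qed (simp add: bessel_square_def)
qed

section \<open>The function \<open>\<Omega>\<close> as an average of squares\<close>

text \<open>
  The sign is put into the coefficients, so that positivity of \<open>\<Omega>\<close> is positivity of a power
  series on the half-line \<open>w \<ge> 0\<close>.
\<close>
definition Omega_coeff :: "real \<Rightarrow> real \<Rightarrow> real \<Rightarrow> nat \<Rightarrow> real" where
  "Omega_coeff a b c k = (-1) ^ k * (pochhammer a k * pochhammer (a + 1/2) k) /
     (pochhammer (c + 1) k * pochhammer (a + b) k * pochhammer (a + b + 1/2) k * fact k)"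

lemma Omega_eq: "Omega a b c x = (\<Sum>k. Omega_coeff a b c k * (x\<^sup>2 / 4) ^ k)"
proof -
  have "(- (x\<^sup>2 / 4)) ^ k = (-1) ^ k * (x\<^sup>2 / 4) ^ k" for k
    by (rule power_minus)
  then show ?thesis
    unfolding Omega_def hyp2F3_def Omega_coeff_def by (simp add: mult_ac)
qed

lemma Omega_nonneg: "nonneg_series (Omega_coeff a b c) \<Longrightarrow> Omega a b c x \<ge> 0"
  by (simp add: Omega_eq nonneg_series_def)

lemma Omega_pos: "pos_series (Omega_coeff a b c) \<Longrightarrow> Omega a b c x > 0"
  by (simp add: Omega_eq pos_series_def)

lemma Omega_coeff_increase_b:
  assumes a: "a > 0" "b > 0" "c > -1" "b \<le> b'" and f: "nonneg_series (Omega_coeff a b c)"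
  shows "nonneg_series (Omega_coeff a b' c)"
    and "b < b' \<Longrightarrow> pos_series (Omega_coeff a b' c)"
proof -
  let ?g = "\<lambda>k. pochhammer (a + b) k / pochhammer (a + b') k *
     (pochhammer (a + b + 1/2) k / pochhammer (a + b' + 1/2) k * Omega_coeff a b c k)"
  have eq: "Omega_coeff a b' c = ?g"
  proof
    fix k
    have "pochhammer (a + b) k > 0" "pochhammer (a + b + 1/2) k > 0"
      using a by (auto intro!: pochhammer_pos)
    then show "Omega_coeff a b' c k = ?g k" by (simp add: Omega_coeff_def)
  qed
  have "nonneg_series (\<lambda>k. pochhammer (a + b + 1/2) k / pochhammer (a + b' + 1/2) k * Omega_coeff a b c k)"
    using a by (intro series_pochhammer_ratio f) auto
  note * = series_pochhammer_ratio[OF this, of "a + b" "a + b'"]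
  show "nonneg_series (Omega_coeff a b' c)" unfolding eq using a by (intro *) auto
  show "pos_series (Omega_coeff a b' c)" if "b < b'" unfolding eq using a that by (intro *) auto
qed

text \<open>
  Start from \<open>\<nu> = a - 1/2\<close>, whose square has numerator \<open>a\<close> and denominators \<open>a + 1/2, 2a\<close>.
  The target has the additional numerator \<open>a + 1/2\<close>, and the triple \<open>a + 1/2, a + 1/2, 2a\<close>
  majorizes its denominators \<open>c + 1 = 2a - 2b + 1/2, a + b, a + b + 1/2\<close>.  Majorization of triples
  is a chain of two steps on pairs: \<open>a + 1/2, 2a\<close> becomes \<open>c + 1, a + 2b\<close>, and then
  \<open>a + 1/2, a + 2b\<close> becomes \<open>a + b, a + b + 1/2\<close>.  The second step is trivial iff \<open>b = 1/2\<close>.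
\<close>
lemma Omega_coeff_first_edge:
  assumes b: "1/2 \<le> b" "2 * b \<le> a" and c: "c = 2 * a - 2 * b - 1/2"
  shows "nonneg_series (Omega_coeff a b c)"
    and "1/2 < b \<Longrightarrow> pos_series (Omega_coeff a b c)"
proof -
  let ?h = "\<lambda>k. balanced_ratio (a + 1/2) (2 * a) (c + 1) (a + 2 * b) k * bessel_square (a - 1/2) k"
  let ?g = "\<lambda>k. balanced_ratio (a + 1/2) (a + 2 * b) (a + b) (a + b + 1/2) k * ?h k"
  have eq: "Omega_coeff a b c = ?g"
  proof
    fix k
    have "pochhammer (a + 1/2) k > 0" "pochhammer (2 * a) k > 0" "pochhammer (a + 2 * b) k > 0"
      using b by (auto intro!: pochhammer_pos)
    then show "Omega_coeff a b c k = ?g k"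
      by (simp add: Omega_coeff_def balanced_ratio_def bessel_square_def add_ac mult_ac)
  qed
  have "nonneg_series ?h"
    using b c by (intro series_balanced_ratio nonneg_series_bessel_square) auto
  note * = series_balanced_ratio[OF this, of "a + 1/2" "a + b" "a + b + 1/2" "a + 2 * b"]
  show "nonneg_series (Omega_coeff a b c)" unfolding eq using b by (intro *) auto
  show "pos_series (Omega_coeff a b c)" if "1/2 < b" unfolding eq using b that by (intro *) auto
qed

text \<open>
  For \<open>a = \<nu>\<close> and for \<open>a = \<nu> + 1/2\<close>, the end points of this edge, one of the numerators
  \<open>a, a + 1/2\<close> is \<open>c + 1\<close> and the other is \<open>\<nu> + 1/2\<close>, so both times \<open>\<Omega>\<close> reduces to the same
  \<open>{}\<^sub>1F\<^sub>2\<close> with numerator \<open>\<nu> + 1/2\<close> and denominators \<open>3\<nu>/2 + 3/4, 3\<nu>/2 + 5/4\<close>.  That function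
  is an average of the square with index \<open>\<nu>\<close>.  Between the end points \<open>\<nu> + 1/2\<close> and \<open>c + 1\<close> lie
  strictly between \<open>a\<close> and \<open>a + 1/2\<close> and have the same sum, so \<open>\<Omega>\<close> is an average of the
  common end point function.
\<close>
lemma Omega_coeff_second_edge:
  assumes \<nu>: "1/2 \<le> \<nu>" "\<nu> < a" "a < \<nu> + 1/2" and c: "c = 2 * a - \<nu> - 1" and b: "b = 3 * \<nu> / 2 + 3/4 - a"
  shows "pos_series (Omega_coeff a b c)"
proof -
  let ?h = "\<lambda>k. balanced_ratio (\<nu> + 1) (2 * \<nu> + 1) (a + b) (a + b + 1/2) k * bessel_square \<nu> k"
  let ?g = "\<lambda>k. balanced_ratio a (a + 1/2) (\<nu> + 1/2) (c + 1) k * ?h k"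
  have eq: "Omega_coeff a b c = ?g"
  proof
    fix k
    have "pochhammer (\<nu> + 1/2) k > 0" "pochhammer (\<nu> + 1) k > 0" "pochhammer (2 * \<nu> + 1) k > 0"
      using \<nu> by (auto intro!: pochhammer_pos)
    then show "Omega_coeff a b c k = ?g k"
      by (simp add: Omega_coeff_def balanced_ratio_def bessel_square_def mult_ac)
  qed
  have "nonneg_series ?h"
    using \<nu> b by (intro series_balanced_ratio nonneg_series_bessel_square) auto
  then show ?thesis unfolding eq using \<nu> c by (intro series_balanced_ratio(2)[of ?h]) auto
qed

lemma Omega_coeff_1F2:
  assumes a: "a > 0" and b: "b > 0" 
  shows "Omega_coeff a b (a - 1) = (\<lambda>k. (-1) ^ k * pochhammer (a + 1/2) k /
     (pochhammer (a + b) k * pochhammer (a + b + 1/2) k * fact k))"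
proof
  fix k
  have "pochhammer a k > 0" using a by (rule pochhammer_pos)
  then show "Omega_coeff a b (a - 1) k = (-1) ^ k * pochhammer (a + 1/2) k /
     (pochhammer (a + b) k * pochhammer (a + b + 1/2) k * fact k)"
    by (simp add: Omega_coeff_def)
qed

text \<open>
  The value of \<open>b\<close> is the one for which the denominators have the same sum as those of the
  square with index \<open>a\<close>, namely \<open>a + 1\<close> and \<open>2a + 1\<close>.
\<close>
lemma Omega_coeff_1F2_edge:
  assumes a: "1/2 \<le> a" and b: "b = a / 2 + 3/4"
  shows "nonneg_series (Omega_coeff a b (a - 1))"
    and "1/2 < a \<Longrightarrow> pos_series (Omega_coeff a b (a - 1))"
proof -
  let ?g = "\<lambda>k. balanced_ratio (a + 1) (2 * a + 1) (a + b) (a + b + 1/2) k * bessel_square a k"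
  have a0: "a > 0" and b0: "b > 0" using a b by auto
  have eq: "Omega_coeff a b (a - 1) = ?g"
  proof
    fix k
    have "pochhammer (a + 1) k > 0" "pochhammer (2 * a + 1) k > 0"
      using a by (auto intro!: pochhammer_pos)
    then show "Omega_coeff a b (a - 1) k = ?g k"
      unfolding Omega_coeff_1F2[OF a0 b0] by (simp add: balanced_ratio_def bessel_square_def)
  qed
  have "nonneg_series (bessel_square a)" using a by (intro nonneg_series_bessel_square) auto
  note * = series_balanced_ratio[OF this, of "a + 1" "a + b" "a + b + 1/2" "2 * a + 1"]
  show "nonneg_series (Omega_coeff a b (a - 1))" unfolding eq using a b by (intro *) auto
  show "pos_series (Omega_coeff a b (a - 1))" if "1/2 < a" unfolding eq using a b that by (intro *) auto
qed

text \<open>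
  For \<open>a < 1/2\<close> both denominators are at least as large as those of the square with index \<open>a\<close>,
  so two Beta averages suffice; the one from \<open>2a + 1\<close> to \<open>a + b + 1/2\<close> is not trivial.
\<close>
lemma Omega_coeff_1F2_small_a:
  assumes a: "0 < a" "a < 1/2" and b: "1 \<le> b"
  shows "pos_series (Omega_coeff a b (a - 1))"
proof -
  let ?h = "\<lambda>k. pochhammer (a + 1) k / pochhammer (a + b) k * bessel_square a k"
  let ?g = "\<lambda>k. pochhammer (2 * a + 1) k / pochhammer (a + b + 1/2) k * ?h k"
  have b0: "b > 0" using b by auto
  have eq: "Omega_coeff a b (a - 1) = ?g"
  proof
    fix k
    have "pochhammer (a + 1) k > 0" "pochhammer (2 * a + 1) k > 0"
      using a by (auto intro!: pochhammer_pos)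
    then show "Omega_coeff a b (a - 1) k = ?g k"
      unfolding Omega_coeff_1F2[OF a(1) b0] by (simp add: bessel_square_def)
  qed
  have "nonneg_series ?h"
    using a b by (intro series_pochhammer_ratio nonneg_series_bessel_square) auto
  then show ?thesis unfolding eq using a b by (intro series_pochhammer_ratio(2)[of ?h]) auto
qed

theorem theorem3p1:
  fixes a b c :: real
  assumes "a > 0" and "b > 0" and "c > -1"
  shows
    "(c / 2 + 3 / 4 \<le> a \<and> a < min (c + 1) (b + c / 2 + 1 / 4) \<and>
      - b + c / 2 + 5 / 4 < 2 * a \<and> 2 * a \<le> b + 3 * c / 2 + 3 / 4
        \<longrightarrow> (\<forall>x>0. Omega a b c x > 0))
   \<and> (a = b + c / 2 + 1 / 4 \<and> 1 / 2 < b \<and> b \<le> c / 2 + 1 / 4 \<and> c > 1 / 2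
        \<longrightarrow> (\<forall>x>0. Omega a b c x > 0))
   \<and> (c = a - 1 \<and> b \<ge> max 1 (1 / 2 * (a + 3 / 2)) \<and> (a, b) \<noteq> (1 / 2, 1)
        \<longrightarrow> (\<forall>x>0. Omega a b c x > 0))
   \<and> (c = a - 1 \<and> (a, b) = (1 / 2, 1)
        \<longrightarrow> (\<forall>x>0. Omega a b c x \<ge> 0))"
proof (intro conjI impI allI; elim conjE)
  fix x :: real
  assume A: "c / 2 + 3 / 4 \<le> a" "a < min (c + 1) (b + c / 2 + 1 / 4)"
    and B: "2 * a \<le> b + 3 * c / 2 + 3 / 4"
  show "Omega a b c x > 0"
  proof (cases "a \<le> c + 1/2")
    case True
    (* (a, b\<^sub>0, c) is the point on the edge a = b + c/2 + 1/4 below (a, b, c). *)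
    define b\<^sub>0 where "b\<^sub>0 = a - c / 2 - 1/4"
    have "nonneg_series (Omega_coeff a b\<^sub>0 c)"
      by (rule Omega_coeff_first_edge) (use A True in \<open>auto simp: b\<^sub>0_def\<close>)
    then have "pos_series (Omega_coeff a b c)"
      by (rule Omega_coeff_increase_b(2)[rotated 4]) (use A assms in \<open>auto simp: b\<^sub>0_def\<close>)
    then show ?thesis by (rule Omega_pos)
  next
    case False
    (* Here the edge 2a = b + 3c/2 + 3/4 is the one met when b decreases. *)
    define b\<^sub>0 where "b\<^sub>0 = 2 * a - 3 * c / 2 - 3/4"
    have edge: "pos_series (Omega_coeff a b\<^sub>0 c)"
      by (rule Omega_coeff_second_edge[of "2 * a - c - 1"])
         (use A False in \<open>auto simp: b\<^sub>0_def field_simps\<close>)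
    have "pos_series (Omega_coeff a b c)"
    proof (cases "b = b\<^sub>0")
      case True
      then show ?thesis using edge by simp
    next
      case neq: False
      show ?thesis
        by (rule Omega_coeff_increase_b(2)[OF _ _ _ _ pos_imp_nonneg_series[OF edge]])
           (use A B False neq assms in \<open>auto simp: b\<^sub>0_def\<close>)
    qed
    then show ?thesis by (rule Omega_pos)
  qed
next
  fix x :: real
  assume "a = b + c / 2 + 1 / 4" "1 / 2 < b" "b \<le> c / 2 + 1 / 4"
  then have "pos_series (Omega_coeff a b c)"
    by (intro Omega_coeff_first_edge) auto
  then show "Omega a b c x > 0" by (rule Omega_pos)
next
  fix x :: real
  assume c: "c = a - 1" and b: "b \<ge> max 1 (1 / 2 * (a + 3 / 2))" and ne: "(a, b) \<noteq> (1 / 2, 1)"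
  show "Omega a b c x > 0"
  proof (cases "a < 1/2")
    case True
    then show ?thesis
      unfolding c using Omega_coeff_1F2_small_a assms b by (intro Omega_pos) auto
  next
    case False
    define b\<^sub>0 where "b\<^sub>0 = a / 2 + 3/4"
    note edge = Omega_coeff_1F2_edge[of a b\<^sub>0]
    have "pos_series (Omega_coeff a b c)"
    proof (cases "b = b\<^sub>0")
      case True
      then show ?thesis using edge(2) False ne c by (auto simp: b\<^sub>0_def)
    next
      case neq: False
      have "nonneg_series (Omega_coeff a b\<^sub>0 c)"
        unfolding c using False by (intro edge) (auto simp: b\<^sub>0_def)
      then show ?thesis
        by (rule Omega_coeff_increase_b(2)[rotated 4]) (use b neq assms in \<open>auto simp: b\<^sub>0_def\<close>)
    qed
    then show ?thesis by (rule Omega_pos)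
  qed
next
  fix x :: real
  assume "c = a - 1" and "(a, b) = (1 / 2, 1)"
  then have "nonneg_series (Omega_coeff a b c)"
    using Omega_coeff_1F2_edge(1)[of a b] by simp
  then show "Omega a b c x \<ge> 0" by (rule Omega_nonneg)
qed

end
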